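(* Let $(W,S)$ be a Coxeter system with $S$ finite, and let $T$ be a cone type of $W$. If $x\in W$ is such that $T=T(x^{-1})$, then $\beta\in\partial T$ if and only if there exists $w\in W$ with $$\Phi(x)\cap\Phi(w)=\{\beta\}.$$ Moreover, if $\beta\in\partial T$ then there exists $w\in W$, independent of $x$, such that $\Phi(x)\cap\Phi(w)=\{\beta\}$ for every $x\in W$ with $T=T(x^{-1})$.
   Context: $\ell$ is the length function. The cone type of $x\in W$ is $T(x)=\{y\in W\mid\ell(xy)=\ell(x)+\ell(y)\}$; a cone type is a set of this form. Root system: $V$ is the real vector space with basis $\{\alpha_s\mid s\in S\}$ and form $\langle\alpha_s,\alpha_t\rangle=-\cos(\pi/m_{s,t})$ ($m_{s,t}$ the order of $st$; value $-1$ if $m_{s,t}=\infty$); $W$ acts by $s\lambda=\lambda-2\langle\lambda,\alpha_s\rangle\alpha_s$; $\Phi=\{w\alpha_s\mid w\in W,s\in S\}$; $\Phi^+$ is the set of roots that are non-negative combinations of the $\alpha_s$ ($\alpha<0$ means $-\alpha\in\Phi^+$). For $\beta=w\alpha_s$, $s_\beta=wsw^{-1}$. $\Phi(w)=\{\alpha\in\Phi^+\mid w^{-1}\alpha<0\}$. Boundary roots: $\partial T$ is the set of $\beta\in\Phi^+$ such that there exist $w\in W$ and $s\in S$ with $w\notin T$ and $s_\beta w=ws\in T$. *)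

theory Defs
  imports Complex_Main "HOL-Algebra.Generated_Groups" "HOL-Algebra.Multiplicative_Group"
begin

definition word_prod :: "('a, 'b) monoid_scheme \<Rightarrow> 'a list \<Rightarrow> 'a" where
  "word_prod W u = foldr (mult W) u \<one>\<^bsub>W\<^esub>"

text \<open>
  The order of \<open>s \<otimes> t\<close> is \<open>group.ord W (s \<otimes>\<^bsub>W\<^esub> t)\<close>; the library gives it the value 0 when the
  order is infinite.
\<close>

abbreviation cox_m :: "('a, 'b) monoid_scheme \<Rightarrow> 'a \<Rightarrow> 'a \<Rightarrow> nat" where
  "cox_m W s t \<equiv> group.ord W (s \<otimes>\<^bsub>W\<^esub> t)"

text \<open>
  The congruence on words over \<open>S\<close> generated by the Coxeter relators \<open>(st)\<^sup>m = 1\<close>, \<open>m\<close> being the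
  order of \<open>st\<close>. For \<open>s = t\<close> we have \<open>m = 1\<close> and the relator is \<open>[s, s]\<close>, so every letter is its own
  inverse modulo the congruence and the quotient of the free monoid on \<open>S\<close> is the group presented
  by these relators; no formal inverse letters are needed. When \<open>st\<close> has infinite order, the
  library value 0 makes the relator the empty word, i.e. no relation is imposed.
\<close>

inductive cox_cong :: "('a, 'b) monoid_scheme \<Rightarrow> 'a set \<Rightarrow> 'a list \<Rightarrow> 'a list \<Rightarrow> bool"
  for W S where
  cox_refl: "u \<in> lists S \<Longrightarrow> cox_cong W S u u"
| cox_sym: "cox_cong W S u v \<Longrightarrow> cox_cong W S v u"
| cox_trans: "cox_cong W S u v \<Longrightarrow> cox_cong W S v w \<Longrightarrow> cox_cong W S u w"
| cox_relator:
    "p \<in> lists S \<Longrightarrow> q \<in> lists S \<Longrightarrow> s \<in> S \<Longrightarrow> t \<in> S \<Longrightarrow>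
      cox_cong W S (p @ concat (replicate (cox_m W s t) [s, t]) @ q) (p @ q)"

text \<open>
  \<open>(W, S)\<close> is a Coxeter system if \<open>S\<close> consists of elements of order 2 and generates \<open>W\<close>, and the
  relators above present \<open>W\<close>. Only one direction is demanded in the last clause, since congruent
  words always have the same product.
\<close>

definition coxeter_system :: "('a, 'b) monoid_scheme \<Rightarrow> 'a set \<Rightarrow> bool" where
  "coxeter_system W S \<longleftrightarrow>
     group W \<and> S \<subseteq> carrier W \<and> (\<forall>s\<in>S. group.ord W s = 2) \<and> generate W S = carrier W \<and>
     (\<forall>u\<in>lists S. \<forall>v\<in>lists S. word_prod W u = word_prod W v \<longrightarrow> cox_cong W S u v)"

definition cox_length :: "('a, 'b) monoid_scheme \<Rightarrow> 'a set \<Rightarrow> 'a \<Rightarrow> nat" where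
  "cox_length W S w = (LEAST n. \<exists>u\<in>lists S. length u = n \<and> word_prod W u = w)"

definition cone_type_of :: "('a, 'b) monoid_scheme \<Rightarrow> 'a set \<Rightarrow> 'a \<Rightarrow> 'a set" where
  "cone_type_of W S x =
     {y \<in> carrier W. cox_length W S (x \<otimes>\<^bsub>W\<^esub> y) = cox_length W S x + cox_length W S y}"

definition cone_type :: "('a, 'b) monoid_scheme \<Rightarrow> 'a set \<Rightarrow> 'a set \<Rightarrow> bool" where
  "cone_type W S T \<longleftrightarrow> (\<exists>x\<in>carrier W. T = cone_type_of W S x)"

text \<open>
  A vector of \<open>V\<close> is represented by its coordinate function in the basis of simple roots:
  \<open>v s\<close> is the coefficient of \<open>\<alpha>\<^sub>s\<close>, and \<open>v\<close> vanishes outside \<open>S\<close>. All roots have this property.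
  The form is only used for finite \<open>S\<close>.
\<close>

definition simple_root :: "'a \<Rightarrow> 'a \<Rightarrow> real" where
  "simple_root s = (\<lambda>t. if t = s then 1 else 0)"

definition cox_coeff :: "('a, 'b) monoid_scheme \<Rightarrow> 'a \<Rightarrow> 'a \<Rightarrow> real" where
  "cox_coeff W s t = (if cox_m W s t = 0 then - 1 else - cos (pi / real (cox_m W s t)))"

definition cox_form :: "('a, 'b) monoid_scheme \<Rightarrow> 'a set \<Rightarrow> ('a \<Rightarrow> real) \<Rightarrow> ('a \<Rightarrow> real) \<Rightarrow> real" where
  "cox_form W S u v = (\<Sum>s\<in>S. \<Sum>t\<in>S. u s * v t * cox_coeff W s t)"

definition simple_refl :: "('a, 'b) monoid_scheme \<Rightarrow> 'a set \<Rightarrow> 'a \<Rightarrow> ('a \<Rightarrow> real) \<Rightarrow> 'a \<Rightarrow> real" where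
  "simple_refl W S s v = (\<lambda>t. v t - 2 * cox_form W S v (simple_root s) * simple_root s t)"

text \<open>
  The action of \<open>w\<close> is the composition of simple reflections along any expression of \<open>w\<close> as a word
  over \<open>S\<close>; for a Coxeter system it does not depend on the expression chosen.
\<close>

definition cox_act :: "('a, 'b) monoid_scheme \<Rightarrow> 'a set \<Rightarrow> 'a \<Rightarrow> ('a \<Rightarrow> real) \<Rightarrow> 'a \<Rightarrow> real" where
  "cox_act W S w v =
     foldr (simple_refl W S) (SOME u. u \<in> lists S \<and> word_prod W u = w) v"

definition roots :: "('a, 'b) monoid_scheme \<Rightarrow> 'a set \<Rightarrow> ('a \<Rightarrow> real) set" where
  "roots W S = {cox_act W S w (simple_root s) | w s. w \<in> carrier W \<and> s \<in> S}"

definition pos_roots :: "('a, 'b) monoid_scheme \<Rightarrow> 'a set \<Rightarrow> ('a \<Rightarrow> real) set" where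
  "pos_roots W S = {\<beta> \<in> roots W S. \<forall>s\<in>S. 0 \<le> \<beta> s}"

text \<open>The reflection \<open>s\<^sub>\<beta> = wsw\<inverse>\<close> for a root \<open>\<beta> = w\<alpha>\<^sub>s\<close>; it is the same for all such \<open>w\<close>, \<open>s\<close>.\<close>

definition root_refl :: "('a, 'b) monoid_scheme \<Rightarrow> 'a set \<Rightarrow> ('a \<Rightarrow> real) \<Rightarrow> 'a" where
  "root_refl W S \<beta> =
     (THE r. \<exists>w\<in>carrier W. \<exists>s\<in>S. \<beta> = cox_act W S w (simple_root s) \<and> r = w \<otimes>\<^bsub>W\<^esub> s \<otimes>\<^bsub>W\<^esub> inv\<^bsub>W\<^esub> w)"

definition inversion_set :: "('a, 'b) monoid_scheme \<Rightarrow> 'a set \<Rightarrow> 'a \<Rightarrow> ('a \<Rightarrow> real) set" where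
  "inversion_set W S w = {\<alpha> \<in> pos_roots W S. - cox_act W S (inv\<^bsub>W\<^esub> w) \<alpha> \<in> pos_roots W S}"

definition boundary_roots :: "('a, 'b) monoid_scheme \<Rightarrow> 'a set \<Rightarrow> 'a set \<Rightarrow> ('a \<Rightarrow> real) set" where
  "boundary_roots W S T =
     {\<beta> \<in> pos_roots W S. \<exists>w\<in>carrier W. \<exists>s\<in>S.
        w \<notin> T \<and> root_refl W S \<beta> \<otimes>\<^bsub>W\<^esub> w = w \<otimes>\<^bsub>W\<^esub> s \<and> w \<otimes>\<^bsub>W\<^esub> s \<in> T}"

end

theory Submission
  imports Defs
begin

text \<open>
  Everything rests on the fact that \<open>w \<alpha>\<^sub>s\<close> is positive exactly when \<open>\<ell>(ws) > \<ell>(w)\<close>. It gives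
  \<open>\<Phi>(ws) = \<Phi>(w) \<union> {w \<alpha>\<^sub>s}\<close> whenever \<open>\<ell>(ws) > \<ell>(w)\<close>, and hence, by induction on \<open>\<ell>(y)\<close>, that
  \<open>y \<in> T(x\<inverse>)\<close> if and only if \<open>\<Phi>(x) \<inter> \<Phi>(y) = {}\<close>. If \<open>w \<notin> T\<close> and \<open>s\<^sub>\<beta> w = ws \<in> T\<close>, then \<open>\<Phi>(w)\<close>
  exceeds \<open>\<Phi>(ws)\<close> by \<open>\<beta>\<close> alone, so \<open>\<Phi>(x) \<inter> \<Phi>(w) = {\<beta>}\<close>, and \<open>w\<close> does not depend on \<open>x\<close>.
  Conversely, if \<open>\<Phi>(x) \<inter> \<Phi>(w) = {\<beta>}\<close>, cut a reduced word of \<open>w\<close> right after the letter at which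
  \<open>\<beta>\<close> enters the inversion set.
\<close>

section \<open>Words and length\<close>

locale coxeter = group W for W :: "('a, 'b) monoid_scheme" (structure) +
  fixes S :: "'a set"
  assumes system: "coxeter_system W S" and finite_S: "finite S"
begin

abbreviation len :: "'a \<Rightarrow> nat" where "len \<equiv> cox_length W S"
abbreviation wp :: "'a list \<Rightarrow> 'a" where "wp \<equiv> word_prod W"
abbreviation act :: "'a \<Rightarrow> ('a \<Rightarrow> real) \<Rightarrow> 'a \<Rightarrow> real" where "act \<equiv> cox_act W S"
abbreviation \<sigma> :: "'a \<Rightarrow> ('a \<Rightarrow> real) \<Rightarrow> 'a \<Rightarrow> real" where "\<sigma> \<equiv> simple_refl W S"
abbreviation form :: "('a \<Rightarrow> real) \<Rightarrow> ('a \<Rightarrow> real) \<Rightarrow> real" where "form \<equiv> cox_form W S"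
abbreviation coeff :: "'a \<Rightarrow> 'a \<Rightarrow> real" where "coeff \<equiv> cox_coeff W"

lemma S_carrier [simp]: "s \<in> S \<Longrightarrow> s \<in> carrier W"
  using system by (auto simp: coxeter_system_def)

lemma ord_S: "s \<in> S \<Longrightarrow> ord s = 2"
  using system by (auto simp: coxeter_system_def)

lemma S_square [simp]: "s \<in> S \<Longrightarrow> s \<otimes> s = \<one>"
  using pow_ord_eq_1[of s] ord_S[of s] by (simp add: numeral_2_eq_2)

lemma S_inv [simp]: "s \<in> S \<Longrightarrow> inv s = s"
  by (simp add: inv_equality)

lemma S_cancel [simp]: "\<lbrakk>x \<in> carrier W; s \<in> S\<rbrakk> \<Longrightarrow> x \<otimes> s \<otimes> s = x"
  by (simp add: m_assoc)

text \<open>Membership in \<open>lists S\<close> stays an atom, so that the classical reasoner does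
  not unfold it letter by letter.\<close>

declare in_listsI [rule del] in_listsD [rule del]

lemma wp_Nil [simp]: "wp [] = \<one>"
  and wp_Cons [simp]: "wp (a # u) = a \<otimes> wp u"
  by (simp_all add: word_prod_def)

lemma wp_closed [simp]: "u \<in> lists S \<Longrightarrow> wp u \<in> carrier W"
  by (induction u) auto

lemma wp_append [simp]: "\<lbrakk>u \<in> lists S; v \<in> lists S\<rbrakk> \<Longrightarrow> wp (u @ v) = wp u \<otimes> wp v"
  by (induction u) (auto simp: m_assoc)

text \<open>Generators are their own inverses, so the inverses that \<open>generate\<close> admits
  are one-letter words too.\<close>

lemma word_exists:
  assumes "w \<in> carrier W" shows "\<exists>u\<in>lists S. wp u = w"
proof -
  have "w \<in> generate W S" using assms system by (simp add: coxeter_system_def)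
  thus ?thesis
  proof (induction rule: generate.induct)
    case one show ?case by (intro bexI[of _ "[]"]) auto
  next
    case (incl h) thus ?case by (intro bexI[of _ "[h]"]) auto
  next
    case (inv h) thus ?case by (intro bexI[of _ "[h]"]) auto
  next
    case (eng h1 h2)
    then obtain u v where "u \<in> lists S" "wp u = h1" "v \<in> lists S" "wp v = h2" by blast
    thus ?case by (intro bexI[of _ "u @ v"]) auto
  qed
qed

lemma len_le: "u \<in> lists S \<Longrightarrow> len (wp u) \<le> length u"
  unfolding cox_length_def by (rule Least_le) blast

lemma reduced_word:
  assumes "w \<in> carrier W" obtains u where "u \<in> lists S" "wp u = w" "length u = len w"
proof -
  have "\<exists>n. \<exists>u\<in>lists S. length u = n \<and> wp u = w" using word_exists[OF assms] by blast
  from LeastI_ex[OF this] show ?thesis using that unfolding cox_length_def by blast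
qed

lemma len_one [simp]: "len \<one> = 0"
  using len_le[of "[]"] by simp

lemma len_mult_le:
  assumes "x \<in> carrier W" "y \<in> carrier W" shows "len (x \<otimes> y) \<le> len x + len y"
proof -
  obtain u v where "u \<in> lists S" "wp u = x" "length u = len x"
    "v \<in> lists S" "wp v = y" "length v = len y"
    using assms by (metis reduced_word)
  thus ?thesis using len_le[of "u @ v"] by simp
qed

text \<open>Relators have even length, 0 for infinite order. Hence all words for a given element
  have the same parity.\<close>

lemma cox_cong_parity: "cox_cong W S u v \<Longrightarrow> even (length u) = even (length v)"
proof (induction rule: cox_cong.induct)
  case (cox_relator p q s t)
  have "even (length (concat (replicate n [s, t])))" for n by (induction n) auto
  thus ?case by simp
qed auto

text \<open>Appending \<open>s\<close> changes the length by at most one in either direction, and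
  parity excludes equality.\<close>

lemma len_mult_S:
  assumes "w \<in> carrier W" "s \<in> S"
  shows "len (w \<otimes> s) = Suc (len w) \<or> len w = Suc (len (w \<otimes> s))"
proof -
  obtain u where u: "u \<in> lists S" "wp u = w" "length u = len w"
    using assms by (metis reduced_word)
  obtain v where v: "v \<in> lists S" "wp v = w \<otimes> s" "length v = len (w \<otimes> s)"
    using assms by (metis reduced_word m_closed S_carrier)
  have "wp (u @ [s]) = wp v" using u v assms by simp
  hence "cox_cong W S (u @ [s]) v" using u v assms system by (auto simp: coxeter_system_def)
  from cox_cong_parity[OF this] have "even (Suc (len w)) = even (len (w \<otimes> s))" using u v by simp
  moreover have "len (w \<otimes> s) \<le> len w + 1" using len_le[of "u @ [s]"] u assms by simp
  moreover have "len w \<le> len (w \<otimes> s) + 1" using len_le[of "v @ [s]"] v assms by simp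
  moreover have "a = Suc b \<or> b = Suc a"
    if "even (Suc b) = even a" "a \<le> b + 1" "b \<le> a + 1" for a b :: nat
    using that by presburger
  ultimately show ?thesis by blast
qed

text \<open>The last letter of a reduced word is a right descent.\<close>

lemma right_descent:
  assumes "w \<in> carrier W" "w \<noteq> \<one>"
  obtains s where "s \<in> S" "len w = Suc (len (w \<otimes> s))"
proof -
  obtain u where u: "u \<in> lists S" "wp u = w" "length u = len w" using assms by (metis reduced_word)
  with assms have "u \<noteq> []" by auto
  then obtain v s where us: "u = v @ [s]" by (metis rev_exhaust)
  hence vs: "v \<in> lists S" "s \<in> S" using u by auto
  hence "w \<otimes> s = wp v" using u us by auto
  hence "len (w \<otimes> s) < len w" using len_le[of v] vs u us by simp
  thus ?thesis using that[of s] len_mult_S[of w s] vs assms by auto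
qed

section \<open>The geometric representation\<close>

lemma ord_swap: "\<lbrakk>s \<in> S; t \<in> S\<rbrakk> \<Longrightarrow> ord (s \<otimes> t) = ord (t \<otimes> s)"
  using ord_inv[of "s \<otimes> t"] by (simp add: inv_mult_group)

lemma coeff_sym: "\<lbrakk>s \<in> S; t \<in> S\<rbrakk> \<Longrightarrow> coeff s t = coeff t s"
  unfolding cox_coeff_def using ord_swap[of s t] by simp

lemma coeff_self [simp]: "s \<in> S \<Longrightarrow> coeff s s = 1"
  unfolding cox_coeff_def using ord_S[of s] by simp

text \<open>A finite order is thus at least 2, which puts \<open>pi / m\<close> strictly between 0
  and \<open>pi\<close>; later proofs divide by its sine.\<close>

lemma ord_ne_1:
  assumes "s \<in> S" "t \<in> S" "s \<noteq> t" shows "ord (s \<otimes> t) \<noteq> 1"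
proof
  assume "ord (s \<otimes> t) = 1"
  hence "s \<otimes> t = \<one>" using ord_eq_1[of "s \<otimes> t"] assms by auto
  hence "inv t = s" using assms by (intro inv_equality) auto
  thus False using assms by simp
qed

lemma form_lin: "form (\<lambda>r. a * u r + b * v r) w = a * form u w + b * form v w"
  unfolding cox_form_def sum_distrib_left sum.distrib[symmetric]
  by (intro sum.cong refl) (simp add: algebra_simps)

lemma form_sym: "form u v = form v u"
proof -
  have "form u v = (\<Sum>t\<in>S. \<Sum>s\<in>S. u s * v t * coeff s t)"
    unfolding cox_form_def by (rule sum.swap)
  also have "\<dots> = form v u"
    unfolding cox_form_def by (intro sum.cong refl) (simp add: coeff_sym mult.commute)
  finally show ?thesis .
qed

lemma form_lin2: "form w (\<lambda>r. a * u r + b * v r) = a * form w u + b * form w v"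
  using form_lin form_sym by metis

lemma form_simple:
  assumes "s \<in> S" "t \<in> S" shows "form (simple_root s) (simple_root t) = coeff s t"
proof -
  have "form (simple_root s) (simple_root t) =
      (\<Sum>a\<in>S. \<Sum>b\<in>S. if b = t then (if a = s then coeff a b else 0) else 0)"
    unfolding cox_form_def simple_root_def by (intro sum.cong refl) auto
  also have "\<dots> = coeff s t" using assms finite_S by (simp add: sum.delta)
  finally show ?thesis .
qed

text \<open>The factor 1 gives the right-hand side the exact shape that \<open>form_lin\<close> and
  \<open>form_lin2\<close> rewrite.\<close>

lemma refl_eq: "\<sigma> s v = (\<lambda>r. 1 * v r + (- 2 * form v (simple_root s)) * simple_root s r)"
  by (simp add: simple_refl_def fun_eq_iff)

lemma refl_lin: "\<sigma> s (\<lambda>r. a * u r + b * v r) = (\<lambda>r. a * \<sigma> s u r + b * \<sigma> s v r)"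
  by (simp add: simple_refl_def form_lin fun_eq_iff algebra_simps)

text \<open>The correction terms have coefficients -2, -2 and 4 and cancel, because
  \<open>simple_root s\<close> has norm 1.\<close>

lemma form_refl:
  assumes "s \<in> S" shows "form (\<sigma> s u) (\<sigma> s v) = form u v"
  unfolding refl_eq form_lin form_lin2 using assms
  by (simp add: form_simple form_sym[of "simple_root s" v] algebra_simps)

lemma refl_self: "s \<in> S \<Longrightarrow> \<sigma> s (simple_root s) = (\<lambda>r. - simple_root s r)"
  by (simp add: simple_refl_def form_simple fun_eq_iff)

lemma refl_refl:
  assumes "s \<in> S" shows "\<sigma> s (\<sigma> s v) = v"
  unfolding refl_eq form_lin using assms
  by (simp add: form_simple fun_eq_iff)

section \<open>Dihedral relations in the geometric representation\<close>

lemma sin_recurrence: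
  fixes x \<theta> :: real
  shows "sin ((x + 2) * \<theta>) = 2 * cos \<theta> * sin ((x + 1) * \<theta>) - sin (x * \<theta>)"
proof -
  have "sin ((x + 1) * \<theta> + \<theta>) + sin ((x + 1) * \<theta> - \<theta>) = 2 * cos \<theta> * sin ((x + 1) * \<theta>)"
    by (simp only: sin_add sin_diff) simp
  moreover have "(x + 1) * \<theta> + \<theta> = (x + 2) * \<theta>" "(x + 1) * \<theta> - \<theta> = x * \<theta>"
    by (simp_all add: algebra_simps)
  ultimately show ?thesis by simp
qed

text \<open>On \<open>v + \<real>\<alpha>\<^sub>s + \<real>\<alpha>\<^sub>t\<close> the two reflections act affinely. Around their common fixed point
  \<open>(p, q)\<close> the successive coordinates satisfy \<open>z (n + 2) = 2 cos \<theta> z (n + 1) - z n\<close>, whose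
  solutions have period \<open>2m\<close> when \<open>\<theta> = \<pi> / m\<close>.\<close>

lemma dihedral_relation:
  assumes s: "s \<in> S" and t: "t \<in> S" and ne: "s \<noteq> t" and m: "ord (s \<otimes> t) = m" "m \<noteq> 0"
  shows "((\<sigma> s \<circ> \<sigma> t) ^^ m) v = v"
proof -
  define \<theta> where "\<theta> = pi / m"
  have m2: "m \<ge> 2" using ord_ne_1[OF s t ne] m by simp
  hence "0 < \<theta>" "\<theta> < pi" using pi_gt_zero by (auto simp: \<theta>_def field_simps)
  hence sin: "sin \<theta> > 0" by (rule sin_gt_zero)
  have cst: "coeff s t = - cos \<theta>" "coeff t s = - cos \<theta>"
    using m coeff_sym[OF s t] by (auto simp: cox_coeff_def \<theta>_def)
  define a b where "a = form v (simple_root s)" and "b = form v (simple_root t)"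
  \<comment> \<open>\<open>p\<close> and \<open>q\<close> solve the linear system that makes
    \<open>v\<close> plus \<open>p\<close> and \<open>q\<close> times the two simple roots
    orthogonal to both of them; its determinant is the square of
    \<open>sin \<theta>\<close>.\<close>
  define p where "p = - (a + b * cos \<theta>) / (sin \<theta>)\<^sup>2"
  define q where "q = - (b + a * cos \<theta>) / (sin \<theta>)\<^sup>2"
  have sin2: "1 - (cos \<theta>)\<^sup>2 = (sin \<theta>)\<^sup>2" by (simp add: sin_squared_eq)
  have "p - q * cos \<theta> = - a * (1 - (cos \<theta>)\<^sup>2) / (sin \<theta>)\<^sup>2"
    unfolding p_def q_def times_divide_eq_left diff_divide_distrib[symmetric]
    by (simp add: algebra_simps power2_eq_square)
  hence pa: "p - q * cos \<theta> = - a" unfolding sin2 using sin by simp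
  have "q - p * cos \<theta> = - b * (1 - (cos \<theta>)\<^sup>2) / (sin \<theta>)\<^sup>2"
    unfolding p_def q_def times_divide_eq_left diff_divide_distrib[symmetric]
    by (simp add: algebra_simps power2_eq_square)
  hence qb: "q - p * cos \<theta> = - b" unfolding sin2 using sin by simp
  \<comment> \<open>\<open>P\<close> and \<open>Q\<close> measure the deviation from the fixed
    point, so both reflections are linear in them.\<close>
  define e where "e P Q = (\<lambda>r. 1 * v r + 1 * ((p + P) * simple_root s r + (q + Q) * simple_root t r))" for P Q
  have fs: "form (e P Q) (simple_root s) = P - Q * cos \<theta>" for P Q
    unfolding e_def form_lin using s t cst pa by (simp add: form_simple a_def algebra_simps)
  have ft: "form (e P Q) (simple_root t) = Q - P * cos \<theta>" for P Q
    unfolding e_def form_lin using s t cst qb by (simp add: form_simple b_def algebra_simps)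
  have rt: "\<sigma> t (e P Q) = e P (2 * cos \<theta> * P - Q)" for P Q
    unfolding simple_refl_def ft by (simp add: e_def fun_eq_iff algebra_simps)
  have rs: "\<sigma> s (e P Q) = e (2 * cos \<theta> * Q - P) Q" for P Q
    unfolding simple_refl_def fs by (simp add: e_def fun_eq_iff algebra_simps)
  \<comment> \<open>The solution of the recurrence with \<open>z 0 = - q\<close> and
    \<open>z 1 = - p\<close>, the deviation of \<open>v\<close> itself.\<close>
  define z where "z x = (- p * sin (x * \<theta>) + q * sin ((x - 1) * \<theta>)) / sin \<theta>" for x :: real
  have z0: "z 0 = - q" and z1: "z 1 = - p" using sin by (simp_all add: z_def)
  have rec: "z (x + 2) = 2 * cos \<theta> * z (x + 1) - z x" for x
  proof -
    have "sin ((x + 2 - 1) * \<theta>) = 2 * cos \<theta> * sin ((x + 1 - 1) * \<theta>) - sin ((x - 1) * \<theta>)"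
      using sin_recurrence[of "x - 1" \<theta>] by (simp add: algebra_simps)
    hence "- p * sin ((x + 2) * \<theta>) + q * sin ((x + 2 - 1) * \<theta>) =
        2 * cos \<theta> * (- p * sin ((x + 1) * \<theta>) + q * sin ((x + 1 - 1) * \<theta>))
        - (- p * sin (x * \<theta>) + q * sin ((x - 1) * \<theta>))"
      unfolding sin_recurrence[of x \<theta>] by (simp only:) (simp add: algebra_simps)
    thus ?thesis unfolding z_def by (simp only: diff_divide_distrib times_divide_eq_right)
  qed
  \<comment> \<open>Each reflection replaces the older of the two coordinates by the next term of
    \<open>z\<close>, so a pair of reflections advances the index by 2.\<close>
  have iter: "((\<sigma> s \<circ> \<sigma> t) ^^ n) v = e (z (2 * n + 1)) (z (2 * n))" for n
  proof (induction n)
    case 0 show ?case using z0 z1 by (simp add: e_def)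
  next
    case (Suc n)
    have "z (2 * real (Suc n)) = 2 * cos \<theta> * z (2 * n + 1) - z (2 * n)"
      using rec[of "2 * n"] by (simp add: algebra_simps)
    moreover have "z (2 * real (Suc n) + 1) = 2 * cos \<theta> * z (2 * real (Suc n)) - z (2 * n + 1)"
      using rec[of "2 * n + 1"] by (simp add: algebra_simps)
    ultimately show ?case using Suc by (simp add: rs rt)
  qed
  have "2 * real m * \<theta> = 2 * pi" using m by (simp add: \<theta>_def)
  hence per: "z (2 * real m + x) = z x" for x
  proof -
    have "(2 * real m + x) * \<theta> = x * \<theta> + 2 * pi"
        "(2 * real m + x - 1) * \<theta> = (x - 1) * \<theta> + 2 * pi"
      using \<open>2 * real m * \<theta> = 2 * pi\<close> by (simp_all add: algebra_simps)
    thus ?thesis unfolding z_def by (simp only: sin_periodic)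
  qed
  have "((\<sigma> s \<circ> \<sigma> t) ^^ m) v = e (z 1) (z 0)"
    using iter[of m] per[of 1] per[of 0] by (simp add: add.commute)
  also have "\<dots> = v" by (simp add: z0 z1 e_def)
  finally show ?thesis .
qed

lemma foldr_relator: "foldr \<sigma> (concat (replicate n [s, t])) v = ((\<sigma> s \<circ> \<sigma> t) ^^ n) v"
  by (induction n) auto

text \<open>For \<open>s = t\<close> the order is 1 and the relator is \<open>[s, s]\<close>; for
  infinite order it is empty; the rest is \<open>dihedral_relation\<close>.\<close>

lemma relator_acts_trivially:
  assumes "s \<in> S" "t \<in> S"
  shows "foldr \<sigma> (concat (replicate (ord (s \<otimes> t)) [s, t])) v = v"
proof (cases "s = t")
  case True
  thus ?thesis using assms by (simp add: refl_refl)
next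
  case False
  thus ?thesis using dihedral_relation[OF assms False refl]
    by (cases "ord (s \<otimes> t) = 0") (simp_all add: foldr_relator)
qed

lemma cox_cong_act: "cox_cong W S u v \<Longrightarrow> foldr \<sigma> u = foldr \<sigma> v"
  by (induction rule: cox_cong.induct) (auto simp: fun_eq_iff relator_acts_trivially)

text \<open>This is where the presentation enters: the word chosen by \<open>SOME\<close> is
  congruent to \<open>u\<close>, and congruent words act alike.\<close>

lemma act_wp:
  assumes "u \<in> lists S" shows "act (wp u) = foldr \<sigma> u"
proof -
  define v where "v = (SOME v. v \<in> lists S \<and> wp v = wp u)"
  have "v \<in> lists S \<and> wp v = wp u" unfolding v_def by (rule someI[of _ u]) (simp add: assms)
  hence "cox_cong W S v u" using assms system by (auto simp: coxeter_system_def)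
  from cox_cong_act[OF this] show ?thesis by (simp add: cox_act_def v_def fun_eq_iff)
qed

lemma act_one [simp]: "act \<one> v = v"
  using act_wp[of "[]"] by simp

lemma act_S: "s \<in> S \<Longrightarrow> act s = \<sigma> s"
  using act_wp[of "[s]"] by (auto simp: fun_eq_iff)

lemma act_mult:
  assumes "x \<in> carrier W" "y \<in> carrier W" shows "act (x \<otimes> y) v = act x (act y v)"
proof -
  obtain a where a: "a \<in> lists S" "wp a = x" using word_exists[OF assms(1)] by blast
  obtain b where b: "b \<in> lists S" "wp b = y" using word_exists[OF assms(2)] by blast
  show ?thesis using a b act_wp[of "a @ b"] act_wp[of a] act_wp[of b] by simp
qed

lemma act_inv_act [simp]:
  assumes "x \<in> carrier W" shows "act (inv x) (act x v) = v"
  using act_mult[of "inv x" x v] assms by simp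

lemma act_act_inv [simp]:
  assumes "x \<in> carrier W" shows "act x (act (inv x) v) = v"
  using act_mult[of x "inv x" v] assms by simp

lemma foldr_refl_lin:
  "foldr \<sigma> u (\<lambda>r. a * f r + b * g r) = (\<lambda>r. a * foldr \<sigma> u f r + b * foldr \<sigma> u g r)"
  by (induction u) (simp_all add: refl_lin)

lemma act_lin:
  assumes "w \<in> carrier W"
  shows "act w (\<lambda>r. a * f r + b * g r) = (\<lambda>r. a * act w f r + b * act w g r)"
proof -
  obtain u where "u \<in> lists S" "wp u = w" using word_exists[OF assms] by blast
  hence *: "act w = foldr \<sigma> u" using act_wp[of u] by simp
  show ?thesis unfolding * by (rule foldr_refl_lin)
qed

lemma act_scale: "w \<in> carrier W \<Longrightarrow> act w (\<lambda>r. a * f r) = (\<lambda>r. a * act w f r)"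
  using act_lin[of w a f 0 f] by simp

lemma act_uminus: "w \<in> carrier W \<Longrightarrow> act w (- f) = - act w f"
  using act_scale[of w "-1" f] by (simp add: fun_Compl_def)

lemma form_act:
  assumes "w \<in> carrier W" shows "form (act w u) (act w v) = form u v"
proof -
  obtain a where a: "a \<in> lists S" "wp a = w" using word_exists[OF assms] by blast
  have "form (foldr \<sigma> a u) (foldr \<sigma> a v) = form u v"
    using a(1) by (induction a) (simp_all add: form_refl)
  thus ?thesis using a act_wp[of a] by simp
qed

end

section \<open>Positivity of roots\<close>

text \<open>The second argument is the last letter, since words are cut and extended on the right;
  the first letter depends on the parity of the length.\<close>

fun alternating :: "'a \<Rightarrow> 'a \<Rightarrow> nat \<Rightarrow> 'a list" where
  "alternating a b 0 = []"
| "alternating a b (Suc k) = alternating b a k @ [b]"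

lemma length_alternating [simp]: "length (alternating a b k) = k"
  by (induction k arbitrary: a b) auto

lemma alternating_lists: "a \<in> A \<Longrightarrow> b \<in> A \<Longrightarrow> alternating a b k \<in> lists A"
  by (induction k arbitrary: a b) auto

lemma alternating_append:
  "alternating a b (j + k) = (if even k then alternating a b j else alternating b a j) @ alternating a b k"
  by (induction k arbitrary: a b) auto

text \<open>A new last letter either repeats the previous one or continues the alternation.\<close>

lemma alternating_or_repetition:
  "u \<in> lists {a, b} \<Longrightarrow> u = alternating a b (length u) \<or> u = alternating b a (length u) \<or>
     (\<exists>p x q. u = p @ [x, x] @ q)"
proof (induction u rule: rev_induct)
  case (snoc x u)
  have x: "x = a \<or> x = b" and u: "u \<in> lists {a, b}" using snoc.prems by auto
  consider "u = []" | v y where "u = v @ [y]" by (metis rev_exhaust)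
  thus ?case
  proof cases
    case 1 thus ?thesis using x by auto
  next
    case 2
    show ?thesis
    proof (cases "y = x")
      case True
      hence "u @ [x] = v @ [x, x] @ []" using 2 by simp
      thus ?thesis by blast
    next
      case False
      have y: "y = a \<or> y = b" using u 2 by auto
      from snoc.IH[OF u] show ?thesis
      proof (elim disjE exE)
        fix p z q assume "u = p @ [z, z] @ q"
        hence "u @ [x] = p @ [z, z] @ (q @ [x])" by simp
        thus ?thesis by blast
      qed (use 2 x y False in auto)
    qed
  qed
qed auto

context coxeter
begin

section \<open>Alternating words and braid relations\<close>

lemma wp_alternating_even:
  assumes "a \<in> S" "b \<in> S" shows "wp (alternating a b (2 * n)) = (a \<otimes> b) [^] n"
proof (induction n)
  case (Suc n)
  have "alternating a b (2 * Suc n) = alternating a b (2 * n) @ [a, b]" by simp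
  thus ?case using Suc assms alternating_lists[of a S b] by (simp del: alternating.simps)
qed simp

text \<open>Starting from \<open>(b \<otimes> a) [^] m = \<one>\<close>, letters pass one at a time
  from one side to the other. The case \<open>k = m\<close> is the braid relation.\<close>

lemma wp_alternating_swap:
  assumes "a \<in> S" "b \<in> S" "ord (a \<otimes> b) = m" "k \<le> 2 * m"
  shows "wp (alternating a b k) = wp (alternating b a (2 * m - k))"
  using assms
proof (induction k arbitrary: a b)
  case 0
  hence "(b \<otimes> a) [^] m = \<one>" using pow_ord_eq_1[of "b \<otimes> a"] ord_swap[of a b] by simp
  thus ?case using wp_alternating_even[of b a m] 0 by simp
next
  case (Suc k)
  define j where "j = 2 * m - Suc k"
  with Suc.prems have j: "2 * m - k = Suc j" by simp
  have al: "alternating b a i \<in> lists S" "alternating a b i \<in> lists S" for i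
    using alternating_lists Suc.prems by auto
  have "wp (alternating a b (Suc k)) = wp (alternating b a k) \<otimes> b"
    using Suc.prems al by simp
  also have "\<dots> = wp (alternating a b (Suc j)) \<otimes> b"
    using Suc.IH[of b a] Suc.prems ord_swap[of a b] j by simp
  also have "\<dots> = wp (alternating b a (2 * m - Suc k))" using Suc.prems al by (simp add: j_def)
  finally show ?case .
qed

text \<open>The two coefficients are consecutive terms of \<open>z\<close>, and each reflection
  shifts this window by one. The induction swaps \<open>a\<close> and \<open>b\<close> and shifts
  \<open>z\<close>, hence the general initial values.\<close>

lemma foldr_refl_alternating:
  fixes z :: "nat \<Rightarrow> real"
  assumes "a \<in> S" "b \<in> S" "coeff a b = - cos \<theta>"
    and "\<And>n. z (n + 2) = 2 * cos \<theta> * z (n + 1) - z n"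
  shows "foldr \<sigma> (alternating a b k) (\<lambda>r. z 1 * simple_root a r + z 0 * simple_root b r) =
    (\<lambda>r. z (Suc k) * simple_root (if even k then a else b) r
       + z k * simple_root (if even k then b else a) r)"
  using assms
proof (induction k arbitrary: a b z)
  case (Suc k)
  have "form (\<lambda>r. z 1 * simple_root a r + z 0 * simple_root b r) (simple_root b) = z 0 - z 1 * cos \<theta>"
    unfolding form_lin using Suc.prems by (simp add: form_simple)
  note F = this
  have z2: "z 2 = 2 * cos \<theta> * z 1 - z 0" using Suc.prems(4)[of 0] by (simp add: numeral_2_eq_2)
  have "\<sigma> b (\<lambda>r. z 1 * simple_root a r + z 0 * simple_root b r) =
      (\<lambda>r. z 2 * simple_root b r + z 1 * simple_root a r)"
    unfolding simple_refl_def F z2 by (simp add: fun_eq_iff algebra_simps)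
  hence "foldr \<sigma> (alternating a b (Suc k)) (\<lambda>r. z 1 * simple_root a r + z 0 * simple_root b r) =
      foldr \<sigma> (alternating b a k) (\<lambda>r. z 2 * simple_root b r + z 1 * simple_root a r)"
    by simp
  also have "\<dots> = (\<lambda>r. z (Suc (Suc k)) * simple_root (if even k then b else a) r
       + z (Suc k) * simple_root (if even k then a else b) r)"
    using Suc.IH[of b a "\<lambda>n. z (Suc n)"] Suc.prems(1-3) Suc.prems(4)[of "Suc _"] coeff_sym[of a b]
    by (simp add: numeral_2_eq_2)
  finally show ?case by simp
qed simp

text \<open>The coefficients are \<open>sin (n * \<theta>) / sin \<theta>\<close> with
  \<open>n\<close> equal to \<open>k\<close> or \<open>k + 1\<close>; as \<open>n\<close> is at most
  the order, the angle does not exceed \<open>pi\<close>.\<close>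

lemma alternating_act_nonneg:
  assumes s: "s \<in> S" and t: "t \<in> S" and ne: "s \<noteq> t"
    and k: "ord (s \<otimes> t) = 0 \<or> k < ord (s \<otimes> t)"
  obtains p q where "0 \<le> p" "0 \<le> q"
    "foldr \<sigma> (alternating s t k) (simple_root s) = (\<lambda>r. p * simple_root s r + q * simple_root t r)"
proof -
  have "\<exists>\<theta> z. coeff s t = - cos \<theta> \<and> (\<forall>n. z (n + 2) = 2 * cos \<theta> * z (n + 1) - z n)
      \<and> z 0 = 0 \<and> z 1 = 1 \<and> 0 \<le> z k \<and> 0 \<le> z (Suc k)"
  proof (cases "ord (s \<otimes> t) = 0")
    case True
    \<comment> \<open>Infinite order is the degenerate angle 0, where the recurrence is solved by
      \<open>z n = n\<close>.\<close>
    thus ?thesis by (intro exI[of _ 0] exI[of _ real]) (simp add: cox_coeff_def)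
  next
    case False
    define \<theta> where "\<theta> = pi / ord (s \<otimes> t)"
    define z where "z n = sin (real n * \<theta>) / sin \<theta>" for n
    have "ord (s \<otimes> t) \<ge> 2" using False ord_ne_1[OF s t ne] by simp
    hence "0 < \<theta>" "\<theta> < pi" using pi_gt_zero by (auto simp: \<theta>_def field_simps)
    hence sin: "sin \<theta> > 0" by (rule sin_gt_zero)
    have "0 \<le> z n" if "n \<le> ord (s \<otimes> t)" for n
    proof -
      have "real n * pi \<le> pi * real (ord (s \<otimes> t))"
        using that by (subst mult.commute) (intro mult_left_mono, auto)
      hence "real n * \<theta> \<le> pi" using False by (simp add: \<theta>_def field_simps)
      hence "0 \<le> sin (real n * \<theta>)" using \<open>0 < \<theta>\<close> by (intro sin_ge_zero) auto
      thus ?thesis using sin by (simp add: z_def)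
    qed
    moreover have "z (n + 2) = 2 * cos \<theta> * z (n + 1) - z n" for n
      using sin_recurrence[of "real n" \<theta>] by (simp add: z_def diff_divide_distrib add.commute)
    moreover have "coeff s t = - cos \<theta>" using False by (simp add: cox_coeff_def \<theta>_def)
    moreover have "z 0 = 0" "z 1 = 1" using sin by (simp_all add: z_def)
    ultimately show ?thesis using k False by (intro exI[of _ \<theta>] exI[of _ z]) auto
  qed
  then obtain \<theta> z where c: "coeff s t = - cos \<theta>"
    and z: "\<And>n. z (n + 2) = 2 * cos \<theta> * z (n + 1) - z n" "z 0 = 0" "z 1 = 1" "0 \<le> z k" "0 \<le> z (Suc k)"
    by blast
  have eq: "foldr \<sigma> (alternating s t k) (simple_root s) =
      (\<lambda>r. z (Suc k) * simple_root (if even k then s else t) r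
       + z k * simple_root (if even k then t else s) r)"
    using foldr_refl_alternating[OF s t c z(1), of k] z(2,3) by simp
  show thesis
  proof (cases "even k")
    case True thus ?thesis using that[of "z (Suc k)" "z k"] z eq by simp
  next
    case False thus ?thesis using that[of "z k" "z (Suc k)"] z eq by (simp add: add.commute)
  qed
qed

text \<open>Write \<open>w = v u\<close> with lengths adding up, \<open>u\<close> a word in \<open>s\<close> and a right descent \<open>t\<close> of \<open>w\<close>, and
  \<open>v\<close> as short as possible. Then \<open>v\<close> sends both \<open>\<alpha>\<^sub>s\<close> and \<open>\<alpha>\<^sub>t\<close> to positive roots by induction,
  and \<open>u \<alpha>\<^sub>s\<close> is a non-negative combination of these two.\<close>

lemma nonneg_of_ascent:
  assumes "w \<in> carrier W" "s \<in> S" "len w < len (w \<otimes> s)"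
  shows "\<forall>r\<in>S. 0 \<le> act w (simple_root s) r"
  using assms
proof (induction "len w" arbitrary: w s rule: less_induct)
  case less
  note w = less.prems(1) and s = less.prems(2) and asc = less.prems(3)
  show ?case
  proof (cases "w = \<one>")
    case True thus ?thesis by (simp add: simple_root_def)
  next
    case False
    then obtain t where t: "t \<in> S" "len w = Suc (len (w \<otimes> t))" using w right_descent by blast
    have ne: "s \<noteq> t" using asc t by auto
    define P where "P = (\<lambda>(v, u). v \<in> carrier W \<and> u \<in> lists {s, t} \<and> w = v \<otimes> wp u \<and> len w = len v + length u)"
    have P0: "P (w \<otimes> t, [t])" using w t by (simp add: P_def)
    obtain v u where vu: "P (v, u)" and min: "\<And>v' u'. P (v', u') \<Longrightarrow> len v \<le> len v'"
      using ex_has_least_nat[of P, OF P0, of "\<lambda>(v, u). len v"] by auto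
    have v: "v \<in> carrier W" and u: "u \<in> lists {s, t}" and wvu: "w = v \<otimes> wp u"
      and lw: "len w = len v + length u" using vu by (auto simp: P_def)
    have lists: "x \<in> lists S" if "x \<in> lists {s, t}" for x using that s t lists_mono[of "{s, t}" S] by blast
    have uS: "u \<in> lists S" using lists u .
    have lv: "len v < len w" using min[OF P0] t by simp
    \<comment> \<open>A descent \<open>x\<close> of \<open>v\<close> could be moved to the front of
      \<open>u\<close>, against the minimality of \<open>len v\<close>.\<close>
    have up: "len v < len (v \<otimes> x)" if x: "x \<in> {s, t}" for x
    proof (rule ccontr)
      have xS: "x \<in> S" using x s t by auto
      assume "\<not> ?thesis"
      hence *: "len v = Suc (len (v \<otimes> x))" using len_mult_S[OF v xS] by auto
      have "w = v \<otimes> x \<otimes> wp (x # u)"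
        using wvu v xS uS by (simp add: m_assoc[symmetric])
      hence "P (v \<otimes> x, x # u)" using * lw u x v xS by (simp add: P_def)
      from min[OF this] show False using * by simp
    qed
    have pos: "\<forall>r\<in>S. 0 \<le> act v (simple_root s) r" "\<forall>r\<in>S. 0 \<le> act v (simple_root t) r"
      using less.hyps[OF lv v s up] less.hyps[OF lv v t(1) up] by auto
    \<comment> \<open>A shorter word for \<open>wp u\<close> would shorten \<open>w\<close>, so
      \<open>u\<close> is reduced.\<close>
    have short: "length u \<le> length u'" if "u' \<in> lists S" "wp u' = wp u" for u'
    proof -
      have "len (v \<otimes> wp u') = len v + length u" using lw wvu that by simp
      thus ?thesis using len_mult_le[of v "wp u'"] len_le[of u'] v that uS by simp
    qed
    have last: "u \<noteq> p @ [s]" for p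
    proof
      assume up: "u = p @ [s]"
      hence p: "p \<in> lists S" using uS by simp
      have "w \<otimes> s = v \<otimes> wp p" using wvu up p v s by (simp add: m_assoc[symmetric])
      hence "len (w \<otimes> s) \<le> len v + length p"
        using len_mult_le[of v "wp p"] len_le[of p] v p by simp
      thus False using asc lw up by simp
    qed
    have norep: "u \<noteq> p @ [x, x] @ q" for p x q
    proof
      assume up: "u = p @ [x, x] @ q"
      hence "p \<in> lists S" "q \<in> lists S" "x \<in> S" using uS by auto
      hence "wp (p @ q) = wp u" "p @ q \<in> lists S"
        using up by (simp_all add: m_assoc[symmetric])
      from short[OF this(2,1)] show False using up by simp
    qed
    define k where "k = length u"
    have ualt: "u = alternating s t k"
    proof -
      consider "u = alternating s t k" | "u = alternating t s k"
        using alternating_or_repetition[OF u] norep unfolding k_def by blast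
      thus ?thesis
      proof cases
        case 2
        thus ?thesis using last[of "alternating s t (k - 1)"] by (cases k) auto
      qed
    qed
    \<comment> \<open>Otherwise the braid relation rewrites the tail of \<open>u\<close> to end in
      \<open>s\<close>, and \<open>s\<close> becomes a right descent of \<open>w\<close>.\<close>
    have "ord (s \<otimes> t) = 0 \<or> k < ord (s \<otimes> t)"
    proof (rule ccontr)
      assume "\<not> ?thesis"
      then obtain m where m: "ord (s \<otimes> t) = Suc m" and "Suc m \<le> k" by (cases "ord (s \<otimes> t)") auto
      then obtain j where kj: "k = j + Suc m" by (metis le_Suc_ex add.commute)
      define p where "p = (if even (Suc m) then alternating s t j else alternating t s j)"
      have up: "u = p @ alternating s t (Suc m)" unfolding p_def ualt kj by (rule alternating_append)
      have p: "p \<in> lists S" and al: "alternating s t i \<in> lists S" "alternating t s i \<in> lists S" for i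
        using alternating_lists[of s S t] alternating_lists[of t S s] s t by (auto simp: p_def)
      have "wp (alternating s t (Suc m)) = wp (alternating t s (Suc m))"
        using wp_alternating_swap[OF s t(1) m, of "Suc m"] by (simp del: alternating.simps)
      hence "wp u = wp ((p @ alternating s t m) @ [s])"
        using up p al s t by simp
      hence "w \<otimes> s = v \<otimes> wp (p @ alternating s t m)"
        using wvu v p al s by (simp add: m_assoc[symmetric])
      hence "len (w \<otimes> s) \<le> len v + length (p @ alternating s t m)"
        using len_mult_le[of v "wp (p @ alternating s t m)"] len_le[of "p @ alternating s t m"] v p al
        by simp
      thus False using asc lw up by simp
    qed
    from alternating_act_nonneg[OF s t(1) ne this] obtain a b where ab: "0 \<le> a" "0 \<le> b"
      "foldr \<sigma> (alternating s t k) (simple_root s) = (\<lambda>r. a * simple_root s r + b * simple_root t r)"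
      by blast
    have "act w (simple_root s) = act v (act (wp u) (simple_root s))"
      using wvu act_mult v uS by simp
    also have "\<dots> = (\<lambda>r. a * act v (simple_root s) r + b * act v (simple_root t) r)"
      using ab(3) ualt act_wp[OF uS] act_lin[OF v] by simp
    finally show ?thesis using ab pos by simp
  qed
qed

text \<open>Vectors are functions on the whole type; this shows that roots vanish off
  \<open>S\<close>, so that their coordinates in \<open>S\<close> determine them.\<close>

lemma act_outside:
  assumes "w \<in> carrier W" "r \<notin> S" shows "act w f r = f r"
proof -
  obtain u where u: "u \<in> lists S" "wp u = w" using word_exists[OF assms(1)] by blast
  have "foldr \<sigma> u f r = f r"
    using u(1) assms(2) by (induction u) (auto simp: simple_refl_def simple_root_def)
  thus ?thesis using u act_wp[of u] by simp
qed

section \<open>Signs of roots\<close>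

lemma root_in: "\<lbrakk>w \<in> carrier W; s \<in> S\<rbrakk> \<Longrightarrow> act w (simple_root s) \<in> roots W S"
  by (auto simp: roots_def)

lemma rootE:
  assumes "\<beta> \<in> roots W S"
  obtains w s where "w \<in> carrier W" "s \<in> S" "\<beta> = act w (simple_root s)"
  using assms by (auto simp: roots_def)

lemma act_root_in:
  assumes "w \<in> carrier W" "\<beta> \<in> roots W S" shows "act w \<beta> \<in> roots W S"
proof -
  obtain v s where "v \<in> carrier W" "s \<in> S" "\<beta> = act v (simple_root s)" using assms(2) by (rule rootE)
  thus ?thesis using root_in[of "w \<otimes> v" s] assms(1) by (simp add: act_mult)
qed

lemma act_mult_S_root: "\<lbrakk>w \<in> carrier W; s \<in> S\<rbrakk> \<Longrightarrow> act (w \<otimes> s) (simple_root s) = - act w (simple_root s)"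
  using act_uminus[of w "simple_root s"] by (simp add: act_mult act_S refl_self fun_Compl_def)

lemma act_simple_pos:
  assumes "w \<in> carrier W" "s \<in> S" "len w < len (w \<otimes> s)"
  shows "act w (simple_root s) \<in> pos_roots W S"
  using nonneg_of_ascent[OF assms] root_in[OF assms(1,2)] by (simp add: pos_roots_def)

text \<open>One of \<open>w\<close> and \<open>w \<otimes> s\<close> ascends under \<open>s\<close>,
  and they send \<open>simple_root s\<close> to opposite roots.\<close>

lemma root_pos_or_neg:
  assumes "\<beta> \<in> roots W S" shows "\<beta> \<in> pos_roots W S \<or> - \<beta> \<in> pos_roots W S"
proof -
  obtain w s where ws: "w \<in> carrier W" "s \<in> S" "\<beta> = act w (simple_root s)" using assms by (rule rootE)
  show ?thesis
  proof (cases "len w < len (w \<otimes> s)")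
    case True thus ?thesis using act_simple_pos ws by simp
  next
    case False
    hence "act (w \<otimes> s) (simple_root s) \<in> pos_roots W S"
      using len_mult_S[OF ws(1,2)] ws by (intro act_simple_pos) auto
    thus ?thesis using act_mult_S_root ws by simp
  qed
qed

lemma root_norm:
  assumes "\<beta> \<in> roots W S" shows "form \<beta> \<beta> = 1"
  using assms by (elim rootE) (simp add: form_act form_simple)

lemma pos_imp_root: "\<beta> \<in> pos_roots W S \<Longrightarrow> \<beta> \<in> roots W S"
  by (simp add: pos_roots_def)

text \<open>All coordinates in \<open>S\<close> would vanish, but roots have norm 1.\<close>

lemma pos_not_neg:
  assumes "\<beta> \<in> pos_roots W S" shows "- \<beta> \<notin> pos_roots W S"
proof
  assume "- \<beta> \<in> pos_roots W S"
  hence "\<forall>r\<in>S. \<beta> r = 0" using assms by (fastforce simp: pos_roots_def)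
  hence "form \<beta> \<beta> = 0" by (simp add: cox_form_def)
  thus False using root_norm[OF pos_imp_root[OF assms]] by simp
qed

lemma neg_pos_iff: "\<beta> \<in> roots W S \<Longrightarrow> - \<beta> \<in> pos_roots W S \<longleftrightarrow> \<beta> \<notin> pos_roots W S"
  using root_pos_or_neg pos_not_neg by blast

lemma act_simple_pos_iff:
  assumes "w \<in> carrier W" "s \<in> S"
  shows "act w (simple_root s) \<in> pos_roots W S \<longleftrightarrow> len w < len (w \<otimes> s)"
proof
  assume pos: "act w (simple_root s) \<in> pos_roots W S"
  show "len w < len (w \<otimes> s)"
  proof (rule ccontr)
    assume "\<not> ?thesis"
    hence "act (w \<otimes> s) (simple_root s) \<in> pos_roots W S"
      using len_mult_S[OF assms] assms by (intro act_simple_pos) auto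
    thus False using pos_not_neg[OF pos] act_mult_S_root assms by simp
  qed
qed (rule act_simple_pos[OF assms])

lemma simple_pos: "s \<in> S \<Longrightarrow> simple_root s \<in> pos_roots W S"
  using root_in[of \<one> s] by (auto simp: pos_roots_def simple_root_def)

text \<open>Only the coordinate at \<open>s\<close> changes, so another positive coordinate survives
  and decides the sign. Without one, \<open>\<gamma>\<close> is a non-negative multiple of
  \<open>simple_root s\<close> of norm 1.\<close>

lemma refl_pos_root:
  assumes s: "s \<in> S" and pos: "\<gamma> \<in> pos_roots W S" and ne: "\<gamma> \<noteq> simple_root s"
  shows "\<sigma> s \<gamma> \<in> pos_roots W S"
proof (cases "\<exists>t\<in>S. t \<noteq> s \<and> \<gamma> t \<noteq> 0")
  case True
  then obtain t where t: "t \<in> S" "t \<noteq> s" "\<gamma> t \<noteq> 0" by blast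
  have "\<gamma> t > 0" using pos t by (auto simp: pos_roots_def order_less_le)
  hence "\<sigma> s \<gamma> t > 0" using t by (simp add: simple_refl_def simple_root_def)
  hence "- \<sigma> s \<gamma> \<notin> pos_roots W S" using t by (auto simp: pos_roots_def not_le intro!: bexI[of _ t])
  moreover have "\<sigma> s \<gamma> \<in> roots W S"
    using act_root_in[of s \<gamma>] pos_imp_root[OF pos] s by (simp add: act_S)
  ultimately show ?thesis using root_pos_or_neg by blast
next
  case False
  obtain w t where w: "w \<in> carrier W" "t \<in> S" "\<gamma> = act w (simple_root t)"
    using pos_imp_root[OF pos] by (rule rootE)
  have "\<gamma> r = 0" if "r \<notin> S" for r
    using act_outside[OF w(1) that] w that by (auto simp: simple_root_def)
  hence eq: "\<gamma> = (\<lambda>r. \<gamma> s * simple_root s r + 0 * simple_root s r)"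
    using False by (auto simp: simple_root_def fun_eq_iff)
  have "form \<gamma> \<gamma> = \<gamma> s * \<gamma> s"
    by (subst (1 2) eq) (simp only: form_lin form_lin2 form_simple[OF s s] coeff_self[OF s], simp)
  hence "(\<gamma> s)\<^sup>2 = 1" using root_norm[OF pos_imp_root[OF pos]] by (simp add: power2_eq_square)
  moreover have "\<gamma> s \<ge> 0" using pos s by (simp add: pos_roots_def)
  ultimately have "\<gamma> s = 1" by (simp add: power2_eq_1_iff)
  hence "\<gamma> = simple_root s" using eq by (simp add: fun_eq_iff)
  thus ?thesis using ne by simp
qed

section \<open>Reflections and roots\<close>

text \<open>A right descent \<open>s\<close> of \<open>g\<close> would make the image of
  \<open>simple_root s\<close> negative.\<close>

lemma act_faithful:
  assumes "g \<in> carrier W" "\<And>s. s \<in> S \<Longrightarrow> act g (simple_root s) = simple_root s"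
  shows "g = \<one>"
proof (rule ccontr)
  assume "g \<noteq> \<one>"
  then obtain s where "s \<in> S" "len g = Suc (len (g \<otimes> s))" using right_descent assms(1) by blast
  thus False using act_simple_pos_iff[of g s] simple_pos[of s] assms by simp
qed

text \<open>The conjugate acts as the orthogonal reflection in the root, by invariance of the form;
  the formula involves \<open>w\<close> and \<open>s\<close> only through that root.\<close>

lemma act_conjugate:
  assumes "w \<in> carrier W" "s \<in> S"
  shows "act (w \<otimes> s \<otimes> inv w) v =
    (\<lambda>r. 1 * v r + (- 2 * form v (act w (simple_root s))) * act w (simple_root s) r)"
proof -
  have "form (act (inv w) v) (simple_root s) = form v (act w (simple_root s))"
    using form_act[of w "act (inv w) v" "simple_root s"] assms by simp
  hence "\<sigma> s (act (inv w) v) =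
      (\<lambda>r. 1 * act (inv w) v r + (- 2 * form v (act w (simple_root s))) * simple_root s r)"
    by (simp only: refl_eq)
  moreover have "act (w \<otimes> s \<otimes> inv w) v = act w (\<sigma> s (act (inv w) v))"
    using assms by (simp add: act_mult act_S)
  ultimately show ?thesis by (simp only: act_lin[OF assms(1)] act_act_inv[OF assms(1)])
qed

text \<open>Equal roots give equal reflections of \<open>V\<close>, and the action is faithful. This
  makes \<open>root_refl\<close> well defined.\<close>

lemma conjugate_eq_of_root_eq:
  assumes w: "w \<in> carrier W" "s \<in> S" and w': "w' \<in> carrier W" "t \<in> S"
    and eq: "act w (simple_root s) = act w' (simple_root t)"
  shows "w \<otimes> s \<otimes> inv w = w' \<otimes> t \<otimes> inv w'"
proof -
  define a b where "a = w \<otimes> s \<otimes> inv w" and "b = w' \<otimes> t \<otimes> inv w'"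
  have ab: "a \<in> carrier W" "b \<in> carrier W" using w w' by (simp_all add: a_def b_def)
  have "act a v = act b v" for v
    unfolding a_def b_def act_conjugate[OF w] act_conjugate[OF w'] eq by simp
  hence "act (a \<otimes> inv b) v = v" for v using ab by (simp add: act_mult)
  hence "a \<otimes> inv b = \<one>" using ab by (intro act_faithful) auto
  hence "inv (inv b) = a" using ab by (intro inv_equality) auto
  hence "a = b" using ab by simp
  thus ?thesis by (simp add: a_def b_def)
qed

text \<open>Applying both reflections to \<open>\<beta>\<close> gives
  \<open>\<beta> = c \<gamma>\<close>, and both roots have norm 1.\<close>

lemma root_eq_of_conjugate_eq:
  assumes w: "w \<in> carrier W" "s \<in> S" and w': "w' \<in> carrier W" "t \<in> S"
    and eq: "w \<otimes> s \<otimes> inv w = w' \<otimes> t \<otimes> inv w'"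
  shows "act w (simple_root s) = act w' (simple_root t) \<or> act w (simple_root s) = - act w' (simple_root t)"
proof -
  define \<beta> \<gamma> where "\<beta> = act w (simple_root s)" and "\<gamma> = act w' (simple_root t)"
  define c where "c = form \<beta> \<gamma>"
  have norm: "form \<beta> \<beta> = 1" "form \<gamma> \<gamma> = 1" using root_norm root_in w w' by (auto simp: \<beta>_def \<gamma>_def)
  have "(\<lambda>r. 1 * \<beta> r + (- 2 * form \<beta> \<beta>) * \<beta> r) = (\<lambda>r. 1 * \<beta> r + (- 2 * form \<beta> \<gamma>) * \<gamma> r)"
    using act_conjugate[OF w, of \<beta>] act_conjugate[OF w', of \<beta>] eq by (simp add: \<beta>_def \<gamma>_def)
  hence bc: "\<beta> r = c * \<gamma> r" for r using norm by (auto simp: c_def fun_eq_iff dest: spec[of _ r])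
  hence \<beta>_eq: "\<beta> = (\<lambda>r. c * \<gamma> r + 0 * \<gamma> r)" by auto
  have "form \<beta> v = c * form \<gamma> v + 0 * form \<gamma> v" for v by (subst \<beta>_eq) (rule form_lin)
  from this[of \<beta>] have "c\<^sup>2 = 1" using norm form_sym[of \<gamma> \<beta>] by (simp add: power2_eq_square c_def)
  hence "c = 1 \<or> c = -1" by (simp add: power2_eq_1_iff)
  thus ?thesis using bc unfolding \<beta>_def[symmetric] \<gamma>_def[symmetric] by (auto simp: fun_eq_iff)
qed

lemma root_refl_eq:
  assumes "w \<in> carrier W" "s \<in> S"
  shows "root_refl W S (act w (simple_root s)) = w \<otimes> s \<otimes> inv w"
  unfolding root_refl_def
proof (rule the_equality)
  show "\<exists>v\<in>carrier W. \<exists>t\<in>S. act w (simple_root s) = act v (simple_root t) \<and>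
      w \<otimes> s \<otimes> inv w = v \<otimes> t \<otimes> inv v"
    using assms by blast
qed (use conjugate_eq_of_root_eq assms in metis)

section \<open>Inversion sets and cone types\<close>

lemma inversion_set_iff:
  assumes "w \<in> carrier W"
  shows "\<alpha> \<in> inversion_set W S w \<longleftrightarrow> \<alpha> \<in> pos_roots W S \<and> act (inv w) \<alpha> \<notin> pos_roots W S"
  using neg_pos_iff act_root_in[of "inv w" \<alpha>] pos_imp_root assms by (auto simp: inversion_set_def)

lemma inversion_set_one: "inversion_set W S \<one> = {}"
  using inversion_set_iff[of \<one>] by auto

text \<open>The reflection \<open>\<sigma> s\<close> preserves the sign of every root except
  \<open>simple_root s\<close> and its negative, so only
  \<open>\<alpha> = act v (simple_root s)\<close> can change status.\<close>

lemma inversion_set_mult_S: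
  assumes v: "v \<in> carrier W" and s: "s \<in> S" and asc: "len v < len (v \<otimes> s)"
  shows "inversion_set W S (v \<otimes> s) = insert (act v (simple_root s)) (inversion_set W S v)"
proof (rule Set.set_eqI)
  fix \<alpha>
  define \<gamma> where "\<gamma> = act (inv v) \<alpha>"
  have \<alpha>: "\<alpha> = act v \<gamma>" using v by (simp add: \<gamma>_def)
  have vs: "act (inv (v \<otimes> s)) \<alpha> = \<sigma> s \<gamma>"
    using v s by (simp add: inv_mult_group act_mult act_S \<gamma>_def)
  have iff: "\<alpha> \<in> inversion_set W S (v \<otimes> s) \<longleftrightarrow> \<alpha> \<in> pos_roots W S \<and> \<sigma> s \<gamma> \<notin> pos_roots W S"
    "\<alpha> \<in> inversion_set W S v \<longleftrightarrow> \<alpha> \<in> pos_roots W S \<and> \<gamma> \<notin> pos_roots W S"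
    using inversion_set_iff[of "v \<otimes> s" \<alpha>] inversion_set_iff[of v \<alpha>] v s vs by (simp_all add: \<gamma>_def)
  have pos: "act v (simple_root s) \<in> pos_roots W S" by (rule act_simple_pos[OF assms])
  have refl: "\<sigma> s (simple_root s) = - simple_root s" using s by (simp add: refl_self fun_Compl_def)
  show "\<alpha> \<in> inversion_set W S (v \<otimes> s) \<longleftrightarrow> \<alpha> \<in> insert (act v (simple_root s)) (inversion_set W S v)"
  proof (cases "\<gamma> = simple_root s")
    case True
    thus ?thesis using iff(1) \<alpha> pos pos_not_neg[OF simple_pos[OF s]] refl by simp
  next
    case False
    hence ne: "\<alpha> \<noteq> act v (simple_root s)" using v by (auto simp: \<gamma>_def)
    show ?thesis
    proof (cases "\<alpha> \<in> pos_roots W S")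
      case True
      hence root: "\<gamma> \<in> roots W S" using act_root_in pos_imp_root v by (simp add: \<gamma>_def)
      have "\<sigma> s \<gamma> \<in> pos_roots W S \<longleftrightarrow> \<gamma> \<in> pos_roots W S"
      proof
        assume "\<gamma> \<in> pos_roots W S" thus "\<sigma> s \<gamma> \<in> pos_roots W S" using refl_pos_root s False by blast
      next
        assume p: "\<sigma> s \<gamma> \<in> pos_roots W S"
        \<comment> \<open>Equality would make \<open>\<alpha>\<close> the negative of the positive
          root \<open>act v (simple_root s)\<close>.\<close>
        have "\<sigma> s \<gamma> \<noteq> simple_root s"
        proof
          assume "\<sigma> s \<gamma> = simple_root s"
          hence "\<gamma> = - simple_root s" using refl_refl[OF s, of \<gamma>] refl by simp
          hence "\<alpha> = - act v (simple_root s)" using \<alpha> act_uminus v by simp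
          thus False using True pos_not_neg[OF pos] by simp
        qed
        from refl_pos_root[OF s p this] show "\<gamma> \<in> pos_roots W S" using refl_refl[OF s] by simp
      qed
      thus ?thesis using iff ne by simp
    qed (use iff ne in simp)
  qed
qed

text \<open>Write \<open>y = v \<otimes> s\<close> with \<open>v\<close> shorter and
  \<open>z = inv x \<otimes> v\<close>. The root gained by passing from \<open>v\<close> to
  \<open>y\<close> avoids the inversion set of \<open>x\<close> exactly when \<open>z\<close>
  ascends under \<open>s\<close>.\<close>

lemma inversion_sets_disjoint_iff:
  assumes x: "x \<in> carrier W" and y: "y \<in> carrier W"
  shows "inversion_set W S x \<inter> inversion_set W S y = {} \<longleftrightarrow> len (inv x \<otimes> y) = len (inv x) + len y"
  using y
proof (induction "len y" arbitrary: y rule: less_induct)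
  case less
  show ?case
  proof (cases "y = \<one>")
    case True thus ?thesis using x by (simp add: inversion_set_one)
  next
    case False
    then obtain s where s: "s \<in> S" "len y = Suc (len (y \<otimes> s))" using less.prems right_descent by blast
    define v where "v = y \<otimes> s"
    have v: "v \<in> carrier W" "y = v \<otimes> s" "len y = Suc (len v)"
      using less.prems s by (simp_all add: v_def)
    define z where "z = inv x \<otimes> v"
    have z: "z \<in> carrier W" "inv x \<otimes> y = z \<otimes> s" using x v s by (simp_all add: z_def m_assoc)
    have ins: "inversion_set W S y = insert (act v (simple_root s)) (inversion_set W S v)"
      using inversion_set_mult_S[OF v(1) s(1)] v by simp
    have "act v (simple_root s) \<in> pos_roots W S" using act_simple_pos[OF v(1) s(1)] v by simp
    moreover have "act (inv x) (act v (simple_root s)) = act z (simple_root s)"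
      using x v s by (simp add: z_def act_mult)
    ultimately have "act v (simple_root s) \<notin> inversion_set W S x \<longleftrightarrow> len z < len (z \<otimes> s)"
      using inversion_set_iff[OF x] act_simple_pos_iff[OF z(1) s(1)] by simp
    moreover have "inversion_set W S x \<inter> inversion_set W S v = {} \<longleftrightarrow> len z = len (inv x) + len v"
      unfolding z_def using less.hyps[of v] v by simp
    ultimately have "inversion_set W S x \<inter> inversion_set W S y = {} \<longleftrightarrow>
        len z = len (inv x) + len v \<and> len z < len (z \<otimes> s)"
      unfolding ins by blast
    \<comment> \<open>By subadditivity of length, the full sum is reached only if \<open>z\<close>
      already has maximal length and \<open>s\<close> adds one more.\<close>
    also have "\<dots> \<longleftrightarrow> len (z \<otimes> s) = len (inv x) + len y"
      using len_mult_S[OF z(1) s(1)] len_mult_le[of "inv x" v] x v unfolding z_def[symmetric] by auto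
    finally show ?thesis using z by simp
  qed
qed

lemma cone_type_of_inv_iff:
  assumes "x \<in> carrier W"
  shows "y \<in> cone_type_of W S (inv x) \<longleftrightarrow> y \<in> carrier W \<and> inversion_set W S x \<inter> inversion_set W S y = {}"
  using inversion_sets_disjoint_iff[OF assms] by (auto simp: cone_type_of_def)

lemma boundary_root_inversion_set:
  assumes x: "x \<in> carrier W" and \<beta>: "\<beta> \<in> pos_roots W S"
    and w: "w \<in> carrier W" and s: "s \<in> S" and out: "w \<notin> cone_type_of W S (inv x)"
    and conj: "root_refl W S \<beta> \<otimes> w = w \<otimes> s" and inside: "w \<otimes> s \<in> cone_type_of W S (inv x)"
  shows "inversion_set W S x \<inter> inversion_set W S w = {\<beta>}"
proof -
  define v where "v = w \<otimes> s"
  have v: "v \<in> carrier W" "w = v \<otimes> s" using w s by (simp_all add: v_def)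
  have dis: "inversion_set W S x \<inter> inversion_set W S v = {}"
    and meet: "inversion_set W S x \<inter> inversion_set W S w \<noteq> {}"
    using cone_type_of_inv_iff[OF x] out inside w by (auto simp: v_def)
  \<comment> \<open>An ascent would put the inversion set of \<open>w\<close> inside that of
    \<open>v\<close>, which misses that of \<open>x\<close>.\<close>
  have "\<not> len w < len (w \<otimes> s)"
    using inversion_set_mult_S[OF w s] dis meet by (auto simp: v_def)
  hence asc: "len v < len (v \<otimes> s)" using len_mult_S[OF w s] w s by (auto simp: v_def)
  hence "inversion_set W S w = insert (act v (simple_root s)) (inversion_set W S v)"
    using inversion_set_mult_S[OF v(1) s] v by simp
  hence single: "inversion_set W S x \<inter> inversion_set W S w = {act v (simple_root s)}"
    using dis meet by auto
  obtain u t where u: "u \<in> carrier W" "t \<in> S" "\<beta> = act u (simple_root t)"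
    using pos_imp_root[OF \<beta>] by (rule rootE)
  \<comment> \<open>The boundary condition says that the reflection of \<open>\<beta>\<close> is
    \<open>s\<close> conjugated by \<open>w\<close>, equally by \<open>v\<close>; this fixes
    \<open>\<beta>\<close> up to sign, and positivity settles the sign.\<close>
  have "u \<otimes> t \<otimes> inv u \<otimes> w = w \<otimes> s" using conj root_refl_eq[OF u(1,2)] u by simp
  hence "u \<otimes> t \<otimes> inv u \<otimes> w \<otimes> inv w = w \<otimes> s \<otimes> inv w" by simp
  hence "u \<otimes> t \<otimes> inv u = w \<otimes> s \<otimes> inv w" using u w by (simp add: m_assoc)
  also have "\<dots> = v \<otimes> s \<otimes> inv v" using w s by (simp add: v_def inv_mult_group m_assoc)
  finally have "\<beta> = act v (simple_root s) \<or> \<beta> = - act v (simple_root s)"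
    using root_eq_of_conjugate_eq u v s by simp
  moreover have "act v (simple_root s) \<in> pos_roots W S" by (rule act_simple_pos[OF v(1) s asc])
  ultimately have "\<beta> = act v (simple_root s)" using \<beta> pos_not_neg by blast
  thus ?thesis using single by simp
qed

lemma inversion_set_boundary_root:
  assumes x: "x \<in> carrier W" and "w \<in> carrier W"
    and "inversion_set W S x \<inter> inversion_set W S w = {\<beta>}"
  shows "\<beta> \<in> boundary_roots W S (cone_type_of W S (inv x))"
  using assms(2,3)
proof (induction "len w" arbitrary: w rule: less_induct)
  case less
  note w = less.prems(1)
  have "w \<noteq> \<one>" using less.prems(2) inversion_set_one by auto
  then obtain s where s: "s \<in> S" "len w = Suc (len (w \<otimes> s))" using w right_descent by blast
  define v where "v = w \<otimes> s"
  have v: "v \<in> carrier W" "w = v \<otimes> s" "len w = Suc (len v)" using w s by (simp_all add: v_def)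
  have ins: "inversion_set W S w = insert (act v (simple_root s)) (inversion_set W S v)"
    using inversion_set_mult_S[OF v(1) s(1)] v by simp
  show ?case
  proof (cases "inversion_set W S x \<inter> inversion_set W S v = {}")
    \<comment> \<open>The last letter of \<open>w\<close> is the one at which \<open>\<beta>\<close>
      enters; this \<open>w\<close> and \<open>s\<close> witness the boundary condition.\<close>
    case True
    hence \<beta>: "\<beta> = act v (simple_root s)" using ins less.prems(2) by blast
    have "root_refl W S \<beta> \<otimes> w = w \<otimes> s"
    proof -
      have "root_refl W S \<beta> \<otimes> w = v \<otimes> (s \<otimes> (inv v \<otimes> (v \<otimes> s)))"
        using \<beta> root_refl_eq[OF v(1) s(1)] v s by (simp add: m_assoc)
      also have "\<dots> = v" using v(1) s by (simp add: m_assoc[symmetric])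
      finally show ?thesis by (simp add: v_def)
    qed
    moreover have "w \<notin> cone_type_of W S (inv x)" "w \<otimes> s \<in> cone_type_of W S (inv x)"
      using cone_type_of_inv_iff[OF x] less.prems(2) True v(1) by (auto simp: v_def)
    moreover have "\<beta> \<in> pos_roots W S" using less.prems(2) by (auto simp: inversion_set_def)
    ultimately show ?thesis using w s by (auto simp: boundary_roots_def)
  next
    case False
    moreover have "inversion_set W S x \<inter> inversion_set W S v \<subseteq> {\<beta>}" using ins less.prems(2) by blast
    ultimately have "inversion_set W S x \<inter> inversion_set W S v = {\<beta>}" by blast
    thus ?thesis using less.hyps[of v] v by simp
  qed
qed

end

theorem theorem2p6:
  fixes W :: "('a, 'b) monoid_scheme" and S T :: "'a set"
  assumes "coxeter_system W S" and "finite S" and "cone_type W S T"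
  shows "(\<forall>x\<in>carrier W. T = cone_type_of W S (inv\<^bsub>W\<^esub> x) \<longrightarrow>
            (\<forall>\<beta>. \<beta> \<in> boundary_roots W S T \<longleftrightarrow>
               (\<exists>w\<in>carrier W. inversion_set W S x \<inter> inversion_set W S w = {\<beta>})))
       \<and> (\<forall>\<beta>\<in>boundary_roots W S T. \<exists>w\<in>carrier W. \<forall>x\<in>carrier W.
            T = cone_type_of W S (inv\<^bsub>W\<^esub> x) \<longrightarrow>
            inversion_set W S x \<inter> inversion_set W S w = {\<beta>})"
proof -
  have "group W" using assms(1) by (simp add: coxeter_system_def)
  then interpret coxeter W S
    using assms by (intro coxeter.intro coxeter_axioms.intro)
  \<comment> \<open>The witness comes from the definition of \<open>boundary_roots\<close>, which
    refers to \<open>T\<close> alone; hence it serves every \<open>x\<close>.\<close>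
  have uniform: "\<exists>w\<in>carrier W. \<forall>x\<in>carrier W. T = cone_type_of W S (inv\<^bsub>W\<^esub> x) \<longrightarrow>
      inversion_set W S x \<inter> inversion_set W S w = {\<beta>}" if "\<beta> \<in> boundary_roots W S T" for \<beta>
  proof -
    obtain w s where "\<beta> \<in> pos_roots W S" "w \<in> carrier W" "s \<in> S" "w \<notin> T"
      "root_refl W S \<beta> \<otimes>\<^bsub>W\<^esub> w = w \<otimes>\<^bsub>W\<^esub> s" "w \<otimes>\<^bsub>W\<^esub> s \<in> T"
      using \<open>\<beta> \<in> boundary_roots W S T\<close> by (auto simp: boundary_roots_def)
    thus ?thesis using boundary_root_inversion_set by blast
  qed
  show ?thesis
  proof (intro conjI ballI impI allI iffI)
    fix x \<beta> assume "x \<in> carrier W" "T = cone_type_of W S (inv\<^bsub>W\<^esub> x)" "\<beta> \<in> boundary_roots W S T"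
    thus "\<exists>w\<in>carrier W. inversion_set W S x \<inter> inversion_set W S w = {\<beta>}" using uniform by blast
  next
    fix x \<beta> assume "x \<in> carrier W" "T = cone_type_of W S (inv\<^bsub>W\<^esub> x)"
      "\<exists>w\<in>carrier W. inversion_set W S x \<inter> inversion_set W S w = {\<beta>}"
    thus "\<beta> \<in> boundary_roots W S T" using inversion_set_boundary_root by blast
  qed (rule uniform)
qed

end
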